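(* Let $G$ be an $m$-dimensional vector-valued bimatrix game and let $(s_1, s_2)$ be a Nash equilibrium of the projected game $G_m$. Let $T_1 = \operatorname{supp}(s_1)$, $T_2 = \operatorname{supp}(s_2)$, let $t_1, t_2$ be the restrictions of $s_1, s_2$ to $T_1, T_2$, and for each $i$ let $\bar{G}_i$ be the subgame of $G_i$ corresponding to $T_1, T_2$. If $(s_1, s_2)$ is a Nash equilibrium of $G_{\leq_{\text{Rlex}}}$, then for all $i \in \{1, \dots, m-1\}$, $(t_1, t_2)$ is a Nash equilibrium of $\bar{G}_i$. If additionally, in $G_m$, all pure-strategy best responses to $s_1$ are in $T_2$ and all pure-strategy best responses to $s_2$ are in $T_1$, then the reverse implication holds as well.
   Context: An $m$-dimensional vector-valued bimatrix game $G$ consists of finite nonempty pure-strategy sets $S_1, S_2$ and payoff maps $u_1, u_2: S_1 \times S_2 \to \mathbb{R}^m$, with players using mixed strategies: $\Delta_k$ is the set of probability distributions on $S_k$, and $u_k(s_1,s_2) = \sum_{\sigma_1\in S_1, \sigma_2 \in S_2} s_1(\sigma_1)s_2(\sigma_2)u_k(\sigma_1,\sigma_2)$ for $(s_1,s_2)\in\Delta_1\times\Delta_2$. Reflected lexicographic order on $\mathbb{R}^m$: $x \leq_{\text{Rlex}} y$ iff $x = y$ or there is $k$ with $x_k < y_k$ and $x_i = y_i$ for all $i > k$. A Nash equilibrium of $G_{\leq_{\text{Rlex}}}$ is $(s_1,s_2)\in\Delta_1\times\Delta_2$ with $u_1(\tilde s_1, s_2) \leq_{\text{Rlex}} u_1(s_1,s_2)$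 for all $\tilde s_1\in\Delta_1$ and $u_2(s_1, \tilde s_2) \leq_{\text{Rlex}} u_2(s_1,s_2)$ for all $\tilde s_2\in\Delta_2$. For $i \in \{1,\dots,m\}$, the $i$-th projected game $G_i$ is the real-valued bimatrix game (mixed extension) with the same strategies whose payoffs are the $i$-th coordinates of those of $G$; its Nash equilibria are the usual ones. A best response of player 1 to $s_2$ in $G_m$ is a strategy maximizing player 1's $G_m$-payoff against $s_2$ (analogously for player 2). The support of a mixed strategy is the set of pure strategies it plays with positive probability. For $T_1\subseteq S_1$, $T_2\subseteq S_2$, the subgame $\bar G_i$ is the real-valued bimatrix game (mixed extension) with pure-strategy sets $T_1, T_2$ and the payoffs of $G_i$ restricted to $T_1\times T_2$. *)

theory Defs
  imports Complex_Main "HOL-Library.FuncSet"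
begin

text \<open>A vector-valued game has payoffs in \<open>nat \<Rightarrow> real\<close>: a vector of
  \<open>\<real>\<^sup>m\<close> is given by its coordinates with indices in \<open>{1..m}\<close>, and coordinates outside
  this range are never inspected. A real-valued game is the instance \<open>'v = real\<close>.\<close>

record ('a, 'b, 'v) game =
  strats1 :: "'a set"
  strats2 :: "'b set"
  pay1 :: "'a \<Rightarrow> 'b \<Rightarrow> 'v"
  pay2 :: "'a \<Rightarrow> 'b \<Rightarrow> 'v"

definition bimatrix_game :: "('a, 'b, 'v) game \<Rightarrow> bool" where
  "bimatrix_game G \<longleftrightarrow>
     finite (strats1 G) \<and> strats1 G \<noteq> {} \<and> finite (strats2 G) \<and> strats2 G \<noteq> {}"

text \<open>Distributions on \<open>S\<close> are functions with domain \<open>S\<close> in the sense of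
  \<^const>\<open>extensional\<close>, so that \<^const>\<open>restrict\<close> is restriction to a subset.\<close>

definition mixed :: "'a set \<Rightarrow> ('a \<Rightarrow> real) set" where
  "mixed S = {s \<in> extensional S. (\<forall>a\<in>S. 0 \<le> s a) \<and> (\<Sum>a\<in>S. s a) = 1}"

definition pure :: "'a set \<Rightarrow> 'a \<Rightarrow> 'a \<Rightarrow> real" where
  "pure S a = (\<lambda>a'\<in>S. if a' = a then 1 else 0)"

definition supp :: "'a set \<Rightarrow> ('a \<Rightarrow> real) \<Rightarrow> 'a set" where
  "supp S s = {a \<in> S. 0 < s a}"

definition expected ::
  "'a set \<Rightarrow> 'b set \<Rightarrow> ('a \<Rightarrow> 'b \<Rightarrow> real) \<Rightarrow> ('a \<Rightarrow> real) \<Rightarrow> ('b \<Rightarrow> real) \<Rightarrow> real" where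
  "expected S1 S2 u s1 s2 = (\<Sum>a\<in>S1. \<Sum>b\<in>S2. s1 a * s2 b * u a b)"

definition payoff1 :: "('a, 'b, real) game \<Rightarrow> ('a \<Rightarrow> real) \<Rightarrow> ('b \<Rightarrow> real) \<Rightarrow> real" where
  "payoff1 H = expected (strats1 H) (strats2 H) (pay1 H)"

definition payoff2 :: "('a, 'b, real) game \<Rightarrow> ('a \<Rightarrow> real) \<Rightarrow> ('b \<Rightarrow> real) \<Rightarrow> real" where
  "payoff2 H = expected (strats1 H) (strats2 H) (pay2 H)"

definition best_response1 :: "('a, 'b, real) game \<Rightarrow> ('b \<Rightarrow> real) \<Rightarrow> ('a \<Rightarrow> real) \<Rightarrow> bool" where
  "best_response1 H s2 s1 \<longleftrightarrow> s1 \<in> mixed (strats1 H) \<and>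
     (\<forall>s1'\<in>mixed (strats1 H). payoff1 H s1' s2 \<le> payoff1 H s1 s2)"

definition best_response2 :: "('a, 'b, real) game \<Rightarrow> ('a \<Rightarrow> real) \<Rightarrow> ('b \<Rightarrow> real) \<Rightarrow> bool" where
  "best_response2 H s1 s2 \<longleftrightarrow> s2 \<in> mixed (strats2 H) \<and>
     (\<forall>s2'\<in>mixed (strats2 H). payoff2 H s1 s2' \<le> payoff2 H s1 s2)"

definition nash :: "('a, 'b, real) game \<Rightarrow> ('a \<Rightarrow> real) \<Rightarrow> ('b \<Rightarrow> real) \<Rightarrow> bool" where
  "nash H s1 s2 \<longleftrightarrow> s1 \<in> mixed (strats1 H) \<and> s2 \<in> mixed (strats2 H) \<and>
     (\<forall>s1'\<in>mixed (strats1 H). payoff1 H s1' s2 \<le> payoff1 H s1 s2) \<and>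
     (\<forall>s2'\<in>mixed (strats2 H). payoff2 H s1 s2' \<le> payoff2 H s1 s2)"

definition subgame :: "('a, 'b, 'v) game \<Rightarrow> 'a set \<Rightarrow> 'b set \<Rightarrow> ('a, 'b, 'v) game" where
  "subgame H T1 T2 =
     \<lparr>strats1 = T1, strats2 = T2,
      pay1 = (\<lambda>a\<in>T1. \<lambda>b\<in>T2. pay1 H a b),
      pay2 = (\<lambda>a\<in>T1. \<lambda>b\<in>T2. pay2 H a b)\<rparr>"

definition projected :: "('a, 'b, nat \<Rightarrow> real) game \<Rightarrow> nat \<Rightarrow> ('a, 'b, real) game" where
  "projected G i =
     \<lparr>strats1 = strats1 G, strats2 = strats2 G,
      pay1 = (\<lambda>a b. pay1 G a b i),
      pay2 = (\<lambda>a b. pay2 G a b i)\<rparr>"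

definition vpayoff1 ::
  "('a, 'b, nat \<Rightarrow> real) game \<Rightarrow> ('a \<Rightarrow> real) \<Rightarrow> ('b \<Rightarrow> real) \<Rightarrow> nat \<Rightarrow> real" where
  "vpayoff1 G s1 s2 = (\<lambda>i. expected (strats1 G) (strats2 G) (\<lambda>a b. pay1 G a b i) s1 s2)"

definition vpayoff2 ::
  "('a, 'b, nat \<Rightarrow> real) game \<Rightarrow> ('a \<Rightarrow> real) \<Rightarrow> ('b \<Rightarrow> real) \<Rightarrow> nat \<Rightarrow> real" where
  "vpayoff2 G s1 s2 = (\<lambda>i. expected (strats1 G) (strats2 G) (\<lambda>a b. pay2 G a b i) s1 s2)"

text \<open>The first disjunct is equality of \<open>x\<close> and \<open>y\<close> as vectors of \<open>\<real>\<^sup>m\<close>.\<close>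

definition Rlex_le :: "nat \<Rightarrow> (nat \<Rightarrow> real) \<Rightarrow> (nat \<Rightarrow> real) \<Rightarrow> bool" where
  "Rlex_le m x y \<longleftrightarrow> (\<forall>i\<in>{1..m}. x i = y i) \<or>
     (\<exists>k\<in>{1..m}. x k < y k \<and> (\<forall>i\<in>{1..m}. k < i \<longrightarrow> x i = y i))"

definition nash_Rlex ::
  "nat \<Rightarrow> ('a, 'b, nat \<Rightarrow> real) game \<Rightarrow> ('a \<Rightarrow> real) \<Rightarrow> ('b \<Rightarrow> real) \<Rightarrow> bool" where
  "nash_Rlex m G s1 s2 \<longleftrightarrow> s1 \<in> mixed (strats1 G) \<and> s2 \<in> mixed (strats2 G) \<and>
     (\<forall>s1'\<in>mixed (strats1 G). Rlex_le m (vpayoff1 G s1' s2) (vpayoff1 G s1 s2)) \<and>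
     (\<forall>s2'\<in>mixed (strats2 G). Rlex_le m (vpayoff2 G s1 s2') (vpayoff2 G s1 s2))"

end

theory Submission
  imports Defs
begin

text \<open>The expected payoff of a player is an average of the payoff vectors of his pure strategies
  against the fixed opponent. In any linear order compatible with the vector space structure,
  an average is maximal among all averages only if all vectors with positive weight are equal
  to it. Hence Rlex-optimality makes each projected payoff constant on the support, and this
  constancy is also what optimality in the subgame amounts to, as the support there is
  full. Conversely, with constancy on the support in all coordinates, a deviation inside the
  support changes nothing, and a deviation that uses a pure strategy outside it loses strictly in
  the dominant coordinate \<open>m\<close>.\<close>

text \<open>Against a fixed opponent, the payoff is linear in a player's own strategy. Stating the
  core lemmas for this functional lets them serve both players, the full game and the
  subgame.\<close>

definition avg :: "'a set \<Rightarrow> ('a \<Rightarrow> real) \<Rightarrow> ('a \<Rightarrow> real) \<Rightarrow> real" where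
  "avg S s v = (\<Sum>a\<in>S. s a * v a)"

lemma pure_in_mixed: "finite S \<Longrightarrow> a \<in> S \<Longrightarrow> pure S a \<in> mixed S"
  by (auto simp: mixed_def pure_def sum.delta cong: sum.cong)

lemma avg_pure:
  assumes "finite S" "a \<in> S"
  shows "avg S (pure S a) v = v a"
proof -
  have "avg S (pure S a) v = (\<Sum>x\<in>S. if x = a then v x else 0)"
    unfolding avg_def pure_def by (rule sum.cong) auto
  also have "\<dots> = v a" using assms by simp
  finally show ?thesis .
qed

lemma avg_const_diff:
  assumes "s \<in> mixed S"
  shows "avg S s v - c = (\<Sum>a\<in>S. s a * (v a - c))"
proof -
  have "(\<Sum>a\<in>S. s a * (v a - c)) = avg S s v - (\<Sum>a\<in>S. s a) * c"
    by (simp add: avg_def right_diff_distrib sum_subtractf sum_distrib_right)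
  then show ?thesis using assms by (simp add: mixed_def)
qed

lemma sum_supp:
  assumes "finite S" "s \<in> mixed S"
  shows "(\<Sum>a\<in>supp S s. s a * v a) = (\<Sum>a\<in>S. s a * v a)"
  by (rule sum.mono_neutral_left)
    (use assms in \<open>auto simp: supp_def mixed_def not_less intro: antisym\<close>)

lemma restrict_supp_in_mixed:
  assumes "finite S" "s \<in> mixed S"
  shows "restrict s (supp S s) \<in> mixed (supp S s)"
  using sum_supp[OF assms, of "\<lambda>_. 1"] assms by (auto simp: mixed_def supp_def)

lemma avg_restrict_supp:
  assumes "finite S" "s \<in> mixed S"
  shows "avg (supp S s) (restrict s (supp S s)) v = avg S s v"
  using sum_supp[OF assms, of v] by (simp add: avg_def)

lemma supp_restrict_supp: "supp (supp S s) (restrict s (supp S s)) = supp S s"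
  by (auto simp: supp_def)

lemma avg_eq_const:
  assumes "finite S" "s \<in> mixed S" "\<And>a. a \<in> supp S s \<Longrightarrow> v a = c"
  shows "avg S s v = c"
proof -
  have "(\<Sum>a\<in>S. s a * (v a - c)) = 0"
    unfolding sum_supp[OF assms(1,2), of "\<lambda>a. v a - c", symmetric]
    by (rule sum.neutral) (simp add: assms(3))
  then show ?thesis using avg_const_diff[OF assms(2), of v c] by simp
qed

text \<open>Deviations from the mean, weighted by positive probabilities, sum to zero; if one of
  them is nonzero, some other or the same one must be positive.\<close>

lemma above_avg_in_supp:
  assumes "finite S" "s \<in> mixed S" "a \<in> supp S s" "v a \<noteq> avg S s v"
  shows "\<exists>a\<in>supp S s. avg S s v < v a"
proof (rule ccontr)
  assume "\<not> ?thesis"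
  then have le: "v x \<le> avg S s v" if "x \<in> supp S s" for x using that by force
  have fin: "finite (supp S s)" using assms(1) by (simp add: supp_def)
  have "(\<Sum>x\<in>supp S s. s x * (v x - avg S s v)) = 0"
    using avg_const_diff[OF assms(2), of v "avg S s v"]
      sum_supp[OF assms(1,2), of "\<lambda>x. v x - avg S s v"] by simp
  \<comment> \<open>Strictness comes from \<open>a\<close>: its deviation is nonzero, hence negative
    by \<open>le\<close>, and its weight is positive.\<close>
  moreover have "(\<Sum>x\<in>supp S s. s x * (v x - avg S s v)) < (\<Sum>x\<in>supp S s. 0)"
  proof (rule sum_strict_mono_ex1[OF fin])
    show "\<forall>x\<in>supp S s. s x * (v x - avg S s v) \<le> 0"
      using le by (auto simp: supp_def mult_le_0_iff)
    show "\<exists>x\<in>supp S s. s x * (v x - avg S s v) < 0"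
      using le[OF assms(3)] assms(3,4) by (auto simp: supp_def mult_less_0_iff intro!: bexI[of _ a])
  qed
  ultimately show False by simp
qed

text \<open>Otherwise some strategy in the support lies above the average, and playing it purely
  would beat \<open>s\<close>.\<close>

lemma supp_maximizer_const:
  assumes "finite S" "s \<in> mixed S" "\<forall>s'\<in>mixed S. avg S s' v \<le> avg S s v" "a \<in> supp S s"
  shows "v a = avg S s v"
proof (rule ccontr)
  assume "v a \<noteq> avg S s v"
  then obtain b where b: "b \<in> supp S s" "avg S s v < v b"
    using above_avg_in_supp assms by metis
  then have "b \<in> S" by (simp add: supp_def)
  then show False
    using b assms(3) pure_in_mixed[OF assms(1)] avg_pure[OF assms(1)] by (metis not_less)
qed

lemma supp_Rlex_maximizer_const:
  assumes S: "finite S" "s \<in> mixed S"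
    and max: "\<forall>s'\<in>mixed S. Rlex_le m (\<lambda>i. avg S s' (f i)) (\<lambda>i. avg S s (f i))"
    and i: "i \<in> {1..m}" and a: "a \<in> supp S s"
  shows "f i a = avg S s (f i)"
proof (rule ccontr)
  assume neq: "f i a \<noteq> avg S s (f i)"
  \<comment> \<open>Rlex is decided by the highest differing coordinate, so the highest coordinate
    that varies on the support is the one to exploit: the pure strategy \<open>b\<close> gains there
    and ties in all coordinates above.\<close>
  define K where "K = {k \<in> {1..m}. \<exists>a\<in>supp S s. f k a \<noteq> avg S s (f k)}"
  define k where "k = Max K"
  have K: "finite K" "K \<noteq> {}" using neq i a by (auto simp: K_def)
  then have "k \<in> K" unfolding k_def by (rule Max_in)
  then obtain b where k: "k \<in> {1..m}" and b: "b \<in> supp S s" "avg S s (f k) < f k b"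
    using above_avg_in_supp[OF S] unfolding K_def by blast
  have above: "f j b = avg S s (f j)" if "j \<in> {1..m}" "k < j" for j
  proof (rule ccontr)
    assume "f j b \<noteq> avg S s (f j)"
    then have "j \<in> K" using that b(1) by (auto simp: K_def)
    then show False using Max_ge[OF K(1)] that(2) by (force simp: k_def)
  qed
  have "b \<in> S" using b by (simp add: supp_def)
  then have "Rlex_le m (\<lambda>i. f i b) (\<lambda>i. avg S s (f i))"
    using bspec[OF max pure_in_mixed[OF S(1)], of b] by (simp add: avg_pure[OF S(1)])
  then consider "f k b = avg S s (f k)"
    | l where "l \<in> {1..m}" "f l b < avg S s (f l)" "\<forall>j\<in>{1..m}. l < j \<longrightarrow> f j b = avg S s (f j)"
    using k unfolding Rlex_le_def by blast
  then show False
  proof cases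
    case 1
    then show False using b by simp
  next
    case 2
    \<comment> \<open>The deciding coordinate \<open>l\<close> has no room: \<open>l > k\<close>
      contradicts the ties in \<open>above\<close>, \<open>l = k\<close> contradicts the gain of
      \<open>b\<close>, and \<open>l < k\<close> would force a tie at \<open>k\<close>.\<close>
    then show False using above[of l] k b by (metis linorder_neqE_nat order_less_asym order_less_irrefl)
  qed
qed

lemma Rlex_maximizer_imp_supp_maximizer:
  assumes S: "finite S" "s \<in> mixed S"
    and max: "\<forall>s'\<in>mixed S. Rlex_le m (\<lambda>i. avg S s' (f i)) (\<lambda>i. avg S s (f i))"
    and i: "i \<in> {1..m}" and t: "t \<in> mixed (supp S s)"
  shows "avg (supp S s) t (f i) \<le> avg (supp S s) (restrict s (supp S s)) (f i)"
proof -
  \<comment> \<open>The required inequality is in fact an equality, since \<open>f i\<close> is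
    constant on the support and \<open>t\<close> lives there.\<close>
  have "avg (supp S s) t (f i) = avg S s (f i)"
  proof (rule avg_eq_const[OF _ t])
    show "finite (supp S s)" using S by (simp add: supp_def)
    show "f i a = avg S s (f i)" if "a \<in> supp (supp S s) t" for a
      using supp_Rlex_maximizer_const[OF S max i] that by (simp add: supp_def)
  qed
  then show ?thesis by (simp add: avg_restrict_supp[OF S])
qed

text \<open>A deviation either loses in coordinate \<open>m\<close>, which settles the comparison at
  once, or ties there; \<open>br\<close> confines the tying ones to the support of \<open>s\<close>,
  where \<open>sub\<close> makes all lower coordinates tie too.\<close>

lemma supp_maximizer_imp_Rlex_maximizer:
  assumes S: "finite S" "s \<in> mixed S" and m: "1 \<le> m"
    and top: "\<forall>s'\<in>mixed S. avg S s' (f m) \<le> avg S s (f m)"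
    and br: "\<And>a. a \<in> S \<Longrightarrow> \<forall>s'\<in>mixed S. avg S s' (f m) \<le> f m a \<Longrightarrow> a \<in> supp S s"
    and sub: "\<And>i t. i \<in> {1..m - 1} \<Longrightarrow> t \<in> mixed (supp S s) \<Longrightarrow>
      avg (supp S s) t (f i) \<le> avg (supp S s) (restrict s (supp S s)) (f i)"
    and s': "s' \<in> mixed S"
  shows "Rlex_le m (\<lambda>i. avg S s' (f i)) (\<lambda>i. avg S s (f i))"
proof (cases "avg S s' (f m) < avg S s (f m)")
  case True
  then show ?thesis using m by (force simp: Rlex_le_def)
next
  case False
  then have eq: "avg S s' (f m) = avg S s (f m)" using top s' by force
  have top': "\<forall>s''\<in>mixed S. avg S s'' (f m) \<le> avg S s' (f m)" using top eq by simp
  \<comment> \<open>A tying \<open>s'\<close> is itself a maximizer of coordinate \<open>m\<close>,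
    so each pure strategy it uses is a best response there and falls under
    \<open>br\<close>.\<close>
  have supp: "a \<in> supp S s" if "a \<in> supp S s'" for a
    using br[of a] top' supp_maximizer_const[OF S(1) s' top' that] that by (simp add: supp_def)
  have fin: "finite (supp S s)" using S by (simp add: supp_def)
  \<comment> \<open>The restriction of \<open>s\<close> has full support in the subgame, so its
    optimality there yields constancy on all of \<open>supp S s\<close>.\<close>
  have const: "f i a = avg S s (f i)" if "i \<in> {1..m - 1}" "a \<in> supp S s" for i a
    using supp_maximizer_const[OF fin restrict_supp_in_mixed[OF S], of "f i" a] sub that
    by (simp add: supp_restrict_supp avg_restrict_supp[OF S])
  have "avg S s' (f i) = avg S s (f i)" if i: "i \<in> {1..m}" for i
  proof (cases "i = m")
    case True
    then show ?thesis using eq by simp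
  next
    case False
    then have "i \<in> {1..m - 1}" using i by auto
    then show ?thesis using avg_eq_const[OF S(1) s'] const supp by blast
  qed
  then show ?thesis by (simp add: Rlex_le_def)
qed

lemma expected_avg1: "expected S1 S2 u s1 s2 = avg S1 s1 (\<lambda>a. avg S2 s2 (\<lambda>b. u a b))"
  by (simp add: expected_def avg_def sum_distrib_left mult.assoc)

lemma expected_avg2: "expected S1 S2 u s1 s2 = avg S2 s2 (\<lambda>b. avg S1 s1 (\<lambda>a. u a b))"
  unfolding expected_def avg_def
  by (subst sum.swap) (simp add: sum_distrib_left mult.assoc mult.left_commute)

theorem theorem4p47:
  fixes G :: "('a, 'b, nat \<Rightarrow> real) game" and m :: nat
    and s1 t1 :: "'a \<Rightarrow> real" and s2 t2 :: "'b \<Rightarrow> real"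
    and T1 :: "'a set" and T2 :: "'b set"
  assumes "bimatrix_game G"
    and "1 \<le> m"
    and "nash (projected G m) s1 s2"
    and "T1 = supp (strats1 G) s1"
    and "T2 = supp (strats2 G) s2"
    and "t1 = restrict s1 T1"
    and "t2 = restrict s2 T2"
  shows "(nash_Rlex m G s1 s2 \<longrightarrow>
            (\<forall>i\<in>{1..m - 1}. nash (subgame (projected G i) T1 T2) t1 t2)) \<and>
         ((\<forall>b\<in>strats2 G. best_response2 (projected G m) s1 (pure (strats2 G) b) \<longrightarrow> b \<in> T2) \<and>
          (\<forall>a\<in>strats1 G. best_response1 (projected G m) s2 (pure (strats1 G) a) \<longrightarrow> a \<in> T1) \<longrightarrow>
          (\<forall>i\<in>{1..m - 1}. nash (subgame (projected G i) T1 T2) t1 t2) \<longrightarrow>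
          nash_Rlex m G s1 s2)"
proof -
  \<comment> \<open>These are the payoffs of pure strategies against the fixed opponent; they turn
    each equilibrium condition into two separate one-player problems.\<close>
  define f where "f = (\<lambda>i a. avg (strats2 G) s2 (\<lambda>b. pay1 G a b i))"
  define g where "g = (\<lambda>i b. avg (strats1 G) s1 (\<lambda>a. pay2 G a b i))"
  have fin: "finite (strats1 G)" "finite (strats2 G)"
    using assms(1) by (auto simp: bimatrix_game_def)
  have mixed: "s1 \<in> mixed (strats1 G)" "s2 \<in> mixed (strats2 G)"
    using assms(3) by (auto simp: nash_def projected_def)
  note S1 = fin(1) mixed(1) and S2 = fin(2) mixed(2)
  note T = assms(4,5) and t = assms(6,7)
  have pay1: "payoff1 (projected G i) s s2 = avg (strats1 G) s (f i)" for i s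
    by (simp add: payoff1_def projected_def expected_avg1 f_def)
  have pay2: "payoff2 (projected G i) s1 s = avg (strats2 G) s (g i)" for i s
    by (simp add: payoff2_def projected_def expected_avg2 g_def)
  have vpay1: "vpayoff1 G s s2 = (\<lambda>i. avg (strats1 G) s (f i))" for s
    by (simp add: vpayoff1_def expected_avg1 f_def)
  have vpay2: "vpayoff2 G s1 s = (\<lambda>i. avg (strats2 G) s (g i))" for s
    by (simp add: vpayoff2_def expected_avg2 g_def)
  \<comment> \<open>The same \<open>f\<close> serves the subgame because \<open>t2\<close> keeps all
    the weight of \<open>s2\<close>. Unfolding \<open>avg\<close> at the end exposes sums over
    \<open>T1\<close> and \<open>T2\<close>, on which the restricted payoffs agree with the original
    ones.\<close>
  have sub1: "payoff1 (subgame (projected G i) T1 T2) s t2 = avg T1 s (f i)" for i s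
  proof -
    have "payoff1 (subgame (projected G i) T1 T2) s t2
        = avg T1 s (\<lambda>a. avg T2 t2 (\<lambda>b. pay1 G a b i))"
      by (simp add: payoff1_def subgame_def projected_def expected_avg1) (simp add: avg_def)
    then show ?thesis by (simp add: T t avg_restrict_supp[OF S2] f_def)
  qed
  have sub2: "payoff2 (subgame (projected G i) T1 T2) t1 s = avg T2 s (g i)" for i s
  proof -
    have "payoff2 (subgame (projected G i) T1 T2) t1 s
        = avg T2 s (\<lambda>b. avg T1 t1 (\<lambda>a. pay2 G a b i))"
      by (simp add: payoff2_def subgame_def projected_def expected_avg2) (simp add: avg_def)
    then show ?thesis by (simp add: T t avg_restrict_supp[OF S1] g_def)
  qed
  have strats: "strats1 (projected G i) = strats1 G" "strats2 (projected G i) = strats2 G"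
    "strats1 (subgame (projected G i) T1 T2) = T1" "strats2 (subgame (projected G i) T1 T2) = T2" for i
    by (simp_all add: projected_def subgame_def)
  have tmixed: "t1 \<in> mixed T1" "t2 \<in> mixed T2"
    unfolding T t by (rule restrict_supp_in_mixed[OF S1] restrict_supp_in_mixed[OF S2])+
  have nash_sub: "nash (subgame (projected G i) T1 T2) t1 t2 \<longleftrightarrow>
      (\<forall>t\<in>mixed T1. avg T1 t (f i) \<le> avg T1 t1 (f i)) \<and>
      (\<forall>t\<in>mixed T2. avg T2 t (g i) \<le> avg T2 t2 (g i))" for i
    by (simp add: nash_def strats sub1 sub2 tmixed)
  have nash_lex: "nash_Rlex m G s1 s2 \<longleftrightarrow>
      (\<forall>s\<in>mixed (strats1 G). Rlex_le m (\<lambda>i. avg (strats1 G) s (f i)) (\<lambda>i. avg (strats1 G) s1 (f i))) \<and>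
      (\<forall>s\<in>mixed (strats2 G). Rlex_le m (\<lambda>i. avg (strats2 G) s (g i)) (\<lambda>i. avg (strats2 G) s2 (g i)))"
    by (simp add: nash_Rlex_def vpay1 vpay2 mixed)
  have top: "\<forall>s\<in>mixed (strats1 G). avg (strats1 G) s (f m) \<le> avg (strats1 G) s1 (f m)"
    "\<forall>s\<in>mixed (strats2 G). avg (strats2 G) s (g m) \<le> avg (strats2 G) s2 (g m)"
    using assms(3) by (simp_all add: nash_def strats pay1 pay2)
  have br1: "best_response1 (projected G m) s2 (pure (strats1 G) a) \<longleftrightarrow>
      (\<forall>s\<in>mixed (strats1 G). avg (strats1 G) s (f m) \<le> f m a)" if "a \<in> strats1 G" for a
    using that by (simp add: best_response1_def strats pay1 pure_in_mixed avg_pure fin)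
  have br2: "best_response2 (projected G m) s1 (pure (strats2 G) b) \<longleftrightarrow>
      (\<forall>s\<in>mixed (strats2 G). avg (strats2 G) s (g m) \<le> g m b)" if "b \<in> strats2 G" for b
    using that by (simp add: best_response2_def strats pay2 pure_in_mixed avg_pure fin)
  show ?thesis
  proof (intro conjI impI)
    assume "nash_Rlex m G s1 s2"
    then show "\<forall>i\<in>{1..m - 1}. nash (subgame (projected G i) T1 T2) t1 t2"
      unfolding nash_lex nash_sub unfolding T t
      using Rlex_maximizer_imp_supp_maximizer[OF S1, of m f]
        Rlex_maximizer_imp_supp_maximizer[OF S2, of m g] by fastforce
  next
    assume br: "(\<forall>b\<in>strats2 G. best_response2 (projected G m) s1 (pure (strats2 G) b) \<longrightarrow> b \<in> T2) \<and>
        (\<forall>a\<in>strats1 G. best_response1 (projected G m) s2 (pure (strats1 G) a) \<longrightarrow> a \<in> T1)"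
      and sub: "\<forall>i\<in>{1..m - 1}. nash (subgame (projected G i) T1 T2) t1 t2"
    show "nash_Rlex m G s1 s2"
      unfolding nash_lex
    proof (intro conjI ballI)
      fix s assume "s \<in> mixed (strats1 G)"
      then show "Rlex_le m (\<lambda>i. avg (strats1 G) s (f i)) (\<lambda>i. avg (strats1 G) s1 (f i))"
        \<comment> \<open>The rotation puts the membership of the deviation first, to meet the
          chained fact; the best-response and subgame premises remain.\<close>
        by (rule supp_maximizer_imp_Rlex_maximizer[where f = f, OF S1 assms(2) top(1), rotated 2])
          (use br br1 sub[unfolded nash_sub] in \<open>simp_all add: T t\<close>)
    next
      fix s assume "s \<in> mixed (strats2 G)"
      then show "Rlex_le m (\<lambda>i. avg (strats2 G) s (g i)) (\<lambda>i. avg (strats2 G) s2 (g i))"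
        by (rule supp_maximizer_imp_Rlex_maximizer[where f = g, OF S2 assms(2) top(2), rotated 2])
          (use br br2 sub[unfolded nash_sub] in \<open>simp_all add: T t\<close>)
    qed
  qed
qed

end
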